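(* Let $d_A,d_B\geq 1$ be integers, let $\alpha,\beta$ be arbitrary real numbers and let $l\geq 1$ be a natural number. If a state (density matrix) $\rho$ on $\mathbb{C}^{d_A}\otimes\mathbb{C}^{d_B}$ is separable, then $$\left\|\mathcal{M}_{\alpha,\beta}^{l}(\rho)\right\|_{tr}\leq\sqrt{(l\alpha^{2}+1)(l\beta^{2}+1)}.$$
   Context: A state on $\mathbb{C}^{d_A}\otimes\mathbb{C}^{d_B}$ is a positive semidefinite $d_Ad_B\times d_Ad_B$ complex matrix of trace $1$. It is separable if $\rho=\sum_i p_i\,\rho_A^i\otimes\rho_B^i$ (finite sum) with $p_i\in[0,1]$, $\sum_i p_i=1$, and $\rho_A^i,\rho_B^i$ (pure) states of the subsystems $A$ and $B$. For $A=[a_{ij}]\in\mathbb{C}^{m\times n}$, $\operatorname{vec}(A)=(a_{11},\dots,a_{m1},a_{12},\dots,a_{m2},\dots,a_{1n},\dots,a_{mn})^T$ (column stacking), $T$ denotes transpose (no conjugation), and $\|A\|_{tr}=\operatorname{tr}\sqrt{A^\dagger A}$ is the trace norm. Realignment: if $Z$ is an $m\times m$ block matrix with blocks $Z_{i,j}\in\mathbb{C}^{n\times n}$, then $\mathcal{R}(Z)$ is the $m^2\times n^2$ matrix whose rows are, in order, $\operatorname{vec}(Z_{1,1})^T,\dots,\operatorname{vec}(Z_{m,1})^T,\dots,\operatorname{vec}(Z_{1,m})^T,\dots,\operatorname{vec}(Z_{m,m})^T$. For $\rho$ on $\mathbb{C}^{d_A}\otimes\mathbb{C}^{d_B}$ take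 $m=d_A$, $n=d_B$. For a matrix $X$, $\omega_l(X)=(\operatorname{vec}(X),\dots,\operatorname{vec}(X))$ is the matrix with $l$ columns all equal to $\operatorname{vec}(X)$. $E_{l\times l}$ is the $l\times l$ matrix with all entries $1$. $\operatorname{tr}_A,\operatorname{tr}_B$ are the partial traces over $A$, $B$. Define $$\mathcal{M}_{\alpha,\beta}^{l}(\rho)=\begin{pmatrix}\alpha\beta E_{l\times l} & \alpha\,\omega_l(\operatorname{tr}_A(\rho))^T\\ \beta\,\omega_l(\operatorname{tr}_B(\rho)) & \mathcal{R}(\rho)\end{pmatrix}\in\mathbb{C}^{(l+d_A^2)\times(l+d_B^2)}.$$ *)

theory Defs
  imports Complex_Main "Jordan_Normal_Form.Schur_Decomposition"
begin

definition mat_trace :: "complex mat \<Rightarrow> complex" where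
  "mat_trace A = (\<Sum>i<dim_row A. A $$ (i, i))"

definition psd_mat :: "complex mat \<Rightarrow> bool" where
  "psd_mat A \<longleftrightarrow> square_mat A \<and> mat_adjoint A = A \<and>
     (\<forall>v \<in> carrier_vec (dim_row A). 0 \<le> Re ((A *\<^sub>v v) \<bullet>c v))"

text \<open>A positive semidefinite matrix has exactly one positive semidefinite square root;
  the value on other matrices is irrelevant.\<close>

definition psd_sqrt :: "complex mat \<Rightarrow> complex mat" where
  "psd_sqrt A = (THE B. B \<in> carrier_mat (dim_row A) (dim_col A) \<and> psd_mat B \<and> B * B = A)"

text \<open>The trace below is that of a positive semidefinite matrix, so \<^term>\<open>Re\<close> is only a coercion
  to the reals.\<close>

definition trace_norm :: "complex mat \<Rightarrow> real" where
  "trace_norm A = Re (mat_trace (psd_sqrt (mat_adjoint A * A)))"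

definition density_mat :: "nat \<Rightarrow> complex mat \<Rightarrow> bool" where
  "density_mat n \<rho> \<longleftrightarrow> \<rho> \<in> carrier_mat n n \<and> psd_mat \<rho> \<and> mat_trace \<rho> = 1"

definition kron :: "complex mat \<Rightarrow> complex mat \<Rightarrow> complex mat" where
  "kron A B = mat (dim_row A * dim_row B) (dim_col A * dim_col B)
     (\<lambda>(i, j). A $$ (i div dim_row B, j div dim_col B) * B $$ (i mod dim_row B, j mod dim_col B))"

text \<open>The convex combination is written entrywise, because \<^term>\<open>sum\<close> is not available on the
  type of matrices of all dimensions. The local states may be mixed.\<close>

definition separable :: "nat \<Rightarrow> nat \<Rightarrow> complex mat \<Rightarrow> bool" where
  "separable dA dB \<rho> \<longleftrightarrow>
     (\<exists>(N::nat) (p :: nat \<Rightarrow> real) \<rho>A \<rho>B.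
        (\<forall>k<N. 0 \<le> p k \<and> p k \<le> 1 \<and> density_mat dA (\<rho>A k) \<and> density_mat dB (\<rho>B k)) \<and>
        (\<Sum>k<N. p k) = 1 \<and>
        \<rho> = mat (dA * dB) (dA * dB)
              (\<lambda>(i, j). \<Sum>k<N. complex_of_real (p k) * kron (\<rho>A k) (\<rho>B k) $$ (i, j)))"

text \<open>Column stacking: entry \<open>(i, j)\<close> goes to position \<open>j * dim_row A + i\<close>.\<close>

definition col_stack :: "complex mat \<Rightarrow> complex vec" where
  "col_stack A = vec (dim_row A * dim_col A) (\<lambda>k. A $$ (k mod dim_row A, k div dim_row A))"

definition mat_block :: "nat \<Rightarrow> complex mat \<Rightarrow> nat \<Rightarrow> nat \<Rightarrow> complex mat" where
  "mat_block n Z i j = mat n n (\<lambda>(a, b). Z $$ (i * n + a, j * n + b))"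

text \<open>The blocks are listed column by column, so row \<open>r\<close> belongs to block
  \<open>(r mod m, r div m)\<close>.\<close>

definition realign :: "nat \<Rightarrow> nat \<Rightarrow> complex mat \<Rightarrow> complex mat" where
  "realign m n Z = mat (m\<^sup>2) (n\<^sup>2) (\<lambda>(r, c). col_stack (mat_block n Z (r mod m) (r div m)) $ c)"

definition ptrace_A :: "nat \<Rightarrow> nat \<Rightarrow> complex mat \<Rightarrow> complex mat" where
  "ptrace_A dA dB \<rho> = mat dB dB (\<lambda>(a, b). \<Sum>i<dA. \<rho> $$ (i * dB + a, i * dB + b))"

definition ptrace_B :: "nat \<Rightarrow> nat \<Rightarrow> complex mat \<Rightarrow> complex mat" where
  "ptrace_B dA dB \<rho> = mat dA dA (\<lambda>(i, j). \<Sum>a<dB. \<rho> $$ (i * dB + a, j * dB + a))"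

definition omega :: "nat \<Rightarrow> complex mat \<Rightarrow> complex mat" where
  "omega l X = mat (dim_row X * dim_col X) l (\<lambda>(i, j). col_stack X $ i)"

definition ones_mat :: "nat \<Rightarrow> complex mat" where
  "ones_mat l = mat l l (\<lambda>(i, j). 1)"

definition M_mat :: "nat \<Rightarrow> nat \<Rightarrow> real \<Rightarrow> real \<Rightarrow> nat \<Rightarrow> complex mat \<Rightarrow> complex mat" where
  "M_mat dA dB \<alpha> \<beta> l \<rho> =
     four_block_mat
       (complex_of_real (\<alpha> * \<beta>) \<cdot>\<^sub>m ones_mat l)
       (complex_of_real \<alpha> \<cdot>\<^sub>m transpose_mat (omega l (ptrace_A dA dB \<rho>)))
       (complex_of_real \<beta> \<cdot>\<^sub>m omega l (ptrace_B dA dB \<rho>))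
       (realign dA dB \<rho>)"

end

theory Submission
  imports Defs "HOL-Analysis.L2_Norm" "Jordan_Normal_Form.Spectral_Radius"
begin

text \<open>If \<open>\<rho> = \<Sum>\<^sub>k p\<^sub>k \<rho>A\<^sub>k \<otimes> \<rho>B\<^sub>k\<close>, then the bordered realignment is the rank-one mixture
  \<open>\<Sum>\<^sub>k p\<^sub>k u\<^sub>k v\<^sub>k\<^sup>T\<close>, where \<open>u\<^sub>k\<close> consists of \<open>l\<close> entries \<open>\<alpha>\<close> followed by \<open>vec \<rho>A\<^sub>k\<close>, and \<open>v\<^sub>k\<close> of
  \<open>l\<close> entries \<open>\<beta>\<close> followed by \<open>vec \<rho>B\<^sub>k\<close>. The purity of a state is at most 1, so \<open>|u\<^sub>k|\<^sup>2 \<le> l \<alpha>\<^sup>2 + 1\<close>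
  and \<open>|v\<^sub>k|\<^sup>2 \<le> l \<beta>\<^sup>2 + 1\<close>. The trace norm of the mixture is at most \<open>\<Sum>\<^sub>k p\<^sub>k |u\<^sub>k| |v\<^sub>k|\<close>: each singular
  value is \<open>\<Sum>\<^sub>k p\<^sub>k \<langle>f\<^sub>i, u\<^sub>k\<rangle> \<langle>v\<^sub>k\<^sup>*, e\<^sub>i\<rangle>\<close> for orthonormal singular vectors \<open>f\<^sub>i\<close>, \<open>e\<^sub>i\<close>, and one sums over
  \<open>i\<close> with Cauchy--Schwarz and Bessel.\<close>

subsection \<open>Adjoints and the spectral theorem\<close>

lemma mat_adjoint_carrier [simp]:
  "A \<in> carrier_mat m n \<Longrightarrow> mat_adjoint A \<in> carrier_mat n m"
  by (auto simp: mat_adjoint_def)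

lemma dim_mat_adjoint [simp]:
  "dim_row (mat_adjoint A) = dim_col A" "dim_col (mat_adjoint A) = dim_row A"
  by (auto simp: mat_adjoint_def)

lemma index_mat_adjoint [simp]:
  fixes A :: "complex mat"
  assumes "i < dim_col A" "j < dim_row A"
  shows "mat_adjoint A $$ (i, j) = cnj (A $$ (j, i))"
  using assms by (simp add: mat_adjoint_def mat_of_rows_def)

lemma mat_adjoint_adjoint [simp]: "mat_adjoint (mat_adjoint A) = (A :: complex mat)"
  by (rule eq_matI) auto

lemma mat_adjoint_mult:
  fixes A B :: "complex mat"
  assumes "A \<in> carrier_mat m k" "B \<in> carrier_mat k n"
  shows "mat_adjoint (A * B) = mat_adjoint B * mat_adjoint A"
  using assms by (intro eq_matI) (auto simp: scalar_prod_def mult.commute)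

lemma mat_adjoint_real_diag:
  "mat_adjoint (mat_diag n (\<lambda>i. complex_of_real (d i))) = mat_diag n (\<lambda>i. complex_of_real (d i))"
  by (rule eq_matI) (auto simp: mat_diag_def)

lemma mat_adjoint_four_block:
  fixes A :: "complex mat"
  assumes "A \<in> carrier_mat m1 n1" "B \<in> carrier_mat m1 n2"
    "C \<in> carrier_mat m2 n1" "D \<in> carrier_mat m2 n2"
  shows "mat_adjoint (four_block_mat A B C D) =
    four_block_mat (mat_adjoint A) (mat_adjoint C) (mat_adjoint B) (mat_adjoint D)"
  using assms by (intro eq_matI) auto

lemma four_block_diag_mult:
  assumes "A \<in> carrier_mat m m" "B \<in> carrier_mat n n" "C \<in> carrier_mat m m" "D \<in> carrier_mat n n"
  shows "four_block_mat A (0\<^sub>m m n) (0\<^sub>m n m) B * four_block_mat C (0\<^sub>m m n) (0\<^sub>m n m) D =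
    four_block_mat (A * C) (0\<^sub>m m n) (0\<^sub>m n m) (B * D)"
  using assms mult_carrier_mat[OF assms(1,3)] mult_carrier_mat[OF assms(2,4)]
  by (subst mult_four_block_mat[of _ m m _ n _ n _ _ m _ n]) auto

lemma mat_trace_comm:
  assumes "A \<in> carrier_mat m n" "B \<in> carrier_mat n m"
  shows "mat_trace (A * B) = mat_trace (B * A)"
proof -
  have "mat_trace (A * B) = (\<Sum>i<m. \<Sum>j<n. A $$ (i, j) * B $$ (j, i))"
    using assms by (auto simp: mat_trace_def scalar_prod_def atLeast0LessThan intro!: sum.cong)
  also have "\<dots> = (\<Sum>j<n. \<Sum>i<m. B $$ (j, i) * A $$ (i, j))"
    by (subst sum.swap) (simp add: mult.commute)
  also have "\<dots> = mat_trace (B * A)"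
    using assms by (auto simp: mat_trace_def scalar_prod_def atLeast0LessThan intro!: sum.cong)
  finally show ?thesis .
qed

lemma unitary_right_inverse:
  fixes U :: "complex mat"
  assumes "U \<in> carrier_mat n n" "mat_adjoint U * U = 1\<^sub>m n"
  shows "U * mat_adjoint U = 1\<^sub>m n"
  using assms by (metis mat_adjoint_carrier mat_mult_left_right_inverse)

text \<open>Supplies the change of basis for the induction in \<open>hermitian_spectral\<close>:
  complete \<open>v\<close> to a basis, apply Gram-Schmidt, and take the normalised vectors as
  columns. Gram-Schmidt keeps the head \<open>v\<close>, so the first column differs from it only by
  a scalar.\<close>

lemma unitary_first_column:
  fixes v :: "complex vec"
  assumes v: "v \<in> carrier_vec n" "v \<noteq> 0\<^sub>v n" and n: "n > 0"
  obtains W c where "W \<in> carrier_mat n n" "mat_adjoint W * W = 1\<^sub>m n" "col W 0 = c \<cdot>\<^sub>v v"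
proof -
  interpret cof_vec_space n "TYPE(complex)" .
  define b where "b = basis_completion v"
  define ws where "ws = gram_schmidt n b"
  from basis_completion[OF v, folded b_def]
  have dist_b: "distinct b" and indep: "\<not> lin_dep (set b)" and b: "set b \<subseteq> carrier_vec n"
    and hdb: "hd b = v" and len_b: "length b = n"
    by auto
  from hdb len_b n obtain vs where bv: "b = v # vs" by (cases b) auto
  from gram_schmidt_result[OF b dist_b indep refl, folded ws_def]
  have ws: "set ws \<subseteq> carrier_vec n" "corthogonal ws" "length ws = n"
    by (auto simp: len_b)
  have "hd ws = v"
    using gram_schmidt_hd[OF v(1), of vs, folded bv] unfolding ws_def .
  then have ws0: "ws ! 0 = v"
    using ws(3) n by (metis hd_conv_nth length_greater_0_conv)
  have wsc: "ws ! i \<in> carrier_vec n" if "i < n" for i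
    using ws that by (metis nth_mem subsetD)
  \<comment> \<open>\<open>gram_schmidt\<close> delivers orthogonal vectors that need not have
    length 1; their squared lengths \<open>s i\<close> give the factors
    \<open>1 / sqrt (s j)\<close> in \<open>W\<close>.\<close>
  define s where "s i = Re (ws ! i \<bullet>c ws ! i)" for i
  have s: "ws ! i \<bullet>c ws ! i = complex_of_real (s i)" "s i > 0" if "i < n" for i
  proof -
    have "ws ! i \<bullet>c ws ! i \<ge> 0" "ws ! i \<bullet>c ws ! i \<noteq> 0"
      using ws that corthogonalD[of ws i i] by (auto intro: conjugate_square_ge_0_vec)
    then show "ws ! i \<bullet>c ws ! i = complex_of_real (s i)" "s i > 0"
      by (auto simp: s_def less_eq_complex_def complex_eq_iff)
  qed
  define W where "W = mat n n (\<lambda>(i, j). complex_of_real (1 / sqrt (s j)) * ws ! j $ i)"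
  have W: "W \<in> carrier_mat n n" by (simp add: W_def)
  have "mat_adjoint W * W = 1\<^sub>m n"
  proof (rule eq_matI)
    fix i j assume ij: "i < dim_row (1\<^sub>m n :: complex mat)" "j < dim_col (1\<^sub>m n :: complex mat)"
    then have i: "i < n" and j: "j < n" by auto
    have "(mat_adjoint W * W) $$ (i, j) =
        complex_of_real (1 / sqrt (s i)) * complex_of_real (1 / sqrt (s j)) * (ws ! j \<bullet>c ws ! i)"
      using i j W wsc[OF i] wsc[OF j]
      by (auto simp: W_def scalar_prod_def sum_distrib_left intro!: sum.cong)
    also have "\<dots> = 1\<^sub>m n $$ (i, j)"
    proof (cases "i = j")
      case True
      have "complex_of_real (1 / sqrt (s i)) * complex_of_real (1 / sqrt (s i)) * complex_of_real (s i)
          = complex_of_real (1 / sqrt (s i) * (1 / sqrt (s i)) * s i)"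
        by (simp only: of_real_mult)
      also have "1 / sqrt (s i) * (1 / sqrt (s i)) * s i = 1"
        using s(2)[OF i] by (simp add: field_simps)
      finally show ?thesis using True s(1)[OF i] i by simp
    next
      case False
      then show ?thesis using corthogonalD[OF ws(2), of j i] ws(3) i j by simp
    qed
    finally show "(mat_adjoint W * W) $$ (i, j) = 1\<^sub>m n $$ (i, j)" .
  qed (use W in auto)
  moreover have "col W 0 = complex_of_real (1 / sqrt (s 0)) \<cdot>\<^sub>v v"
    using v(1) n by (intro eq_vecI) (auto simp: W_def ws0)
  ultimately show ?thesis using W that by blast
qed

lemma unitary_conj_conj:
  fixes P :: "complex mat"
  assumes "P \<in> carrier_mat n n" "Q \<in> carrier_mat n n" "D \<in> carrier_mat n n"
  shows "P * (Q * D * mat_adjoint Q) * mat_adjoint P = (P * Q) * D * mat_adjoint (P * Q)"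
proof -
  have [simp]: "mat_adjoint P \<in> carrier_mat n n" "mat_adjoint Q \<in> carrier_mat n n"
    using assms by auto
  note [simp] = mult_carrier_mat[of _ n n _ n]
  show ?thesis
    using assms by (simp add: mat_adjoint_mult[of _ n n _ n] assoc_mult_mat[of _ n n _ n _ n])
qed

text \<open>Induction on the dimension by deflation. In an orthonormal basis that starts with an
  eigenvector, the first column becomes \<open>(e, 0, ..., 0)\<close>; hermiticity then clears the
  first row, makes \<open>e\<close> real, and leaves a Hermitian block \<open>A3\<close> of size
  \<open>n\<close> for the induction hypothesis.\<close>

theorem hermitian_spectral:
  fixes A :: "complex mat"
  assumes "A \<in> carrier_mat n n" "mat_adjoint A = A"
  obtains U d where "U \<in> carrier_mat n n" "mat_adjoint U * U = 1\<^sub>m n"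
    "A = U * mat_diag n (\<lambda>i. complex_of_real (d i)) * mat_adjoint U"
  using assms
proof (induction n arbitrary: A thesis)
  case 0
  show ?case
    by (rule 0(1)[of "1\<^sub>m 0" "\<lambda>_. 0"]) (use 0(2) in \<open>auto intro!: eq_matI\<close>)
next
  case (Suc n)
  note A = \<open>A \<in> carrier_mat (Suc n) (Suc n)\<close>
  obtain e where "eigenvalue A e"
    using spectrum_non_empty[OF A] by (auto simp: spectrum_def)
  then obtain v where v: "v \<in> carrier_vec (Suc n)" "v \<noteq> 0\<^sub>v (Suc n)" "A *\<^sub>v v = e \<cdot>\<^sub>v v"
    using A by (auto simp: eigenvalue_def eigenvector_def)
  obtain W c where W: "W \<in> carrier_mat (Suc n) (Suc n)"
    and WW: "mat_adjoint W * W = 1\<^sub>m (Suc n)" and W0: "col W 0 = c \<cdot>\<^sub>v v"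
    using unitary_first_column[OF v(1,2)] by auto
  have WW': "W * mat_adjoint W = 1\<^sub>m (Suc n)"
    using unitary_right_inverse[OF W WW] .
  have W' [simp]: "mat_adjoint W \<in> carrier_mat (Suc n) (Suc n)" using W by simp
  note [simp] = mult_carrier_mat[of _ "Suc n" "Suc n" _ "Suc n"]
  define A' where "A' = mat_adjoint W * A * W"
  have A': "A' \<in> carrier_mat (Suc n) (Suc n)" using W A by (simp add: A'_def)
  have A'h: "mat_adjoint A' = A'"
    using A W Suc.prems(3) unfolding A'_def
    by (simp add: mat_adjoint_mult[of _ "Suc n" "Suc n" _ "Suc n"]
        assoc_mult_mat[of _ "Suc n" "Suc n" _ "Suc n" _ "Suc n"])
  have h: "A' $$ (j, i) = cnj (A' $$ (i, j))" if "i < Suc n" "j < Suc n" for i j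
    using that A' by (subst A'h[symmetric]) auto
  have "A *\<^sub>v col W 0 = e \<cdot>\<^sub>v col W 0"
    using v A by (simp add: W0 mult_mat_vec smult_smult_assoc mult.commute)
  then have AW: "col (A * W) 0 = e \<cdot>\<^sub>v col W 0"
    by (subst col_mult2[OF A W]) simp_all
  \<comment> \<open>The first column of \<open>A * W\<close> is \<open>e\<close> times that of
    \<open>W\<close>, and the adjoint of \<open>W\<close> sends the first column of \<open>W\<close>
    to the first unit vector.\<close>
  have col0: "A' $$ (i, 0) = (if i = 0 then e else 0)" if i: "i < Suc n" for i
  proof -
    have "A' = mat_adjoint W * (A * W)"
      using A W unfolding A'_def by (intro assoc_mult_mat) auto
    then have "A' $$ (i, 0) = (mat_adjoint W * (A * W)) $$ (i, 0)"
      by simp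
    also have "\<dots> = e * (row (mat_adjoint W) i \<bullet> col W 0)"
      using A W i AW by simp
    also have "row (mat_adjoint W) i \<bullet> col W 0 = (mat_adjoint W * W) $$ (i, 0)"
      using W i by simp
    finally show ?thesis using WW i by simp
  qed
  have e: "e = complex_of_real (Re e)"
    using h[of 0 0] col0[of 0] by (simp add: complex_eq_iff)
  define A3 where "A3 = mat n n (\<lambda>(i, j). A' $$ (Suc i, Suc j))"
  have A3: "A3 \<in> carrier_mat n n" by (simp add: A3_def)
  have A3h: "mat_adjoint A3 = A3"
    by (intro eq_matI) (auto simp: A3_def intro: h[symmetric])
  obtain U d where U: "U \<in> carrier_mat n n" "mat_adjoint U * U = 1\<^sub>m n"
    and A3U: "A3 = U * mat_diag n (\<lambda>i. complex_of_real (d i)) * mat_adjoint U"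
    by (rule Suc.IH[OF _ A3 A3h])
  \<comment> \<open>The diagonalisation of \<open>A3\<close> is lifted to size \<open>Suc n\<close>:
    \<open>U'\<close> fixes the first coordinate, and \<open>d'\<close> places \<open>Re e\<close>
    in front of the shifted \<open>d\<close>.\<close>
  define E where "E = mat 1 1 (\<lambda>_. e)"
  define U' where "U' = four_block_mat (1\<^sub>m 1) (0\<^sub>m 1 n) (0\<^sub>m n 1) U"
  define d' where "d' i = (case i of 0 \<Rightarrow> Re e | Suc i \<Rightarrow> d i)" for i
  have E: "E \<in> carrier_mat 1 1" by (simp add: E_def)
  have U': "U' \<in> carrier_mat (Suc n) (Suc n)"
    using four_block_carrier_mat[of "1\<^sub>m 1" 1 1 U n n] U(1) by (simp add: U'_def)
  have adj0: "mat_adjoint (0\<^sub>m a b :: complex mat) = 0\<^sub>m b a" "mat_adjoint (1\<^sub>m a :: complex mat) = 1\<^sub>m a" for a b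
    by (auto intro!: eq_matI)
  have U'a: "mat_adjoint U' = four_block_mat (1\<^sub>m 1) (0\<^sub>m 1 n) (0\<^sub>m n 1) (mat_adjoint U)"
    unfolding U'_def using U(1) by (subst mat_adjoint_four_block[of _ 1 1 _ n _ n]) (auto simp: adj0)
  have U'U': "mat_adjoint U' * U' = 1\<^sub>m (Suc n)"
    unfolding U'a unfolding U'_def using U
    by (simp add: four_block_diag_mult del: One_nat_def) simp
  have D: "mat_diag (Suc n) (\<lambda>i. complex_of_real (d' i)) =
      four_block_mat E (0\<^sub>m 1 n) (0\<^sub>m n 1) (mat_diag n (\<lambda>i. complex_of_real (d i)))"
    using e by (intro eq_matI) (auto simp: mat_diag_def E_def d'_def split: nat.splits)
  have Dc [simp]: "mat_diag n f \<in> carrier_mat n n" for f :: "nat \<Rightarrow> complex" by simp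
  have "A' = four_block_mat E (0\<^sub>m 1 n) (0\<^sub>m n 1) A3"
  proof (rule eq_matI)
    fix i j assume "i < dim_row (four_block_mat E (0\<^sub>m 1 n) (0\<^sub>m n 1) A3)"
      "j < dim_col (four_block_mat E (0\<^sub>m 1 n) (0\<^sub>m n 1) A3)"
    then have ij: "i < Suc n" "j < Suc n" using E A3 by auto
    show "A' $$ (i, j) = four_block_mat E (0\<^sub>m 1 n) (0\<^sub>m n 1) A3 $$ (i, j)"
      using ij col0[of i] col0[of j] h[of j 0] E A3 by (auto simp: E_def A3_def)
  qed (use A' E A3 in auto)
  also have "\<dots> = U' * mat_diag (Suc n) (\<lambda>i. complex_of_real (d' i)) * mat_adjoint U'"
    unfolding U'a D unfolding U'_def A3U using U E
    by (simp add: four_block_diag_mult mult_carrier_mat[of _ n n _ n] del: One_nat_def)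
  finally have A'U: "A' = U' * mat_diag (Suc n) (\<lambda>i. complex_of_real (d' i)) * mat_adjoint U'" .
  have "A = W * A' * mat_adjoint W"
  proof -
    have "W * A' * mat_adjoint W = (W * mat_adjoint W) * A * (W * mat_adjoint W)"
      using A W by (simp add: A'_def assoc_mult_mat[of _ "Suc n" "Suc n" _ "Suc n" _ "Suc n"])
    then show ?thesis using A by (simp add: WW')
  qed
  also have "\<dots> = (W * U') * mat_diag (Suc n) (\<lambda>i. complex_of_real (d' i)) * mat_adjoint (W * U')"
    unfolding A'U using W U' by (intro unitary_conj_conj) auto
  finally have "A = (W * U') * mat_diag (Suc n) (\<lambda>i. complex_of_real (d' i)) * mat_adjoint (W * U')" .
  moreover have "mat_adjoint (W * U') * (W * U') = mat_adjoint U' * (mat_adjoint W * W) * U'"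
    using W U' mat_adjoint_carrier[OF U']
    by (simp add: mat_adjoint_mult[OF W U'] assoc_mult_mat[of _ "Suc n" "Suc n" _ "Suc n" _ "Suc n"])
  then have "mat_adjoint (W * U') * (W * U') = 1\<^sub>m (Suc n)"
    using U'U' by (simp add: WW right_mult_one_mat[OF mat_adjoint_carrier[OF U']])
  ultimately show ?case
    using Suc.prems(1)[of "W * U'" d'] W U' by simp
qed

lemma mat_trace_diag: "mat_trace (mat_diag n f) = (\<Sum>i<n. f i)"
  by (simp add: mat_trace_def mat_diag_def)

lemma mat_trace_unitary_conj:
  fixes U :: "complex mat"
  assumes "U \<in> carrier_mat n n" "mat_adjoint U * U = 1\<^sub>m n" "D \<in> carrier_mat n n"
  shows "mat_trace (U * D * mat_adjoint U) = mat_trace D"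
proof -
  have "mat_trace (U * D * mat_adjoint U) = mat_trace (mat_adjoint U * (U * D))"
    using assms by (intro mat_trace_comm[of _ n n] mult_carrier_mat) auto
  also have "mat_adjoint U * (U * D) = (mat_adjoint U * U) * D"
    using assms by (intro assoc_mult_mat[symmetric]) auto
  finally show ?thesis using assms by simp
qed

lemma inner_mat_adjoint:
  fixes A :: "complex mat"
  assumes "A \<in> carrier_mat m n" "w \<in> carrier_vec m" "v \<in> carrier_vec n"
  shows "(mat_adjoint A *\<^sub>v w) \<bullet>c v = w \<bullet>c (A *\<^sub>v v)"
proof -
  have "(mat_adjoint A *\<^sub>v w) \<bullet>c v = (\<Sum>j<n. \<Sum>i<m. cnj (A $$ (i, j)) * w $ i * cnj (v $ j))"
    using assms by (auto simp: scalar_prod_def sum_distrib_right atLeast0LessThan intro!: sum.cong)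
  also have "\<dots> = (\<Sum>i<m. \<Sum>j<n. w $ i * (cnj (A $$ (i, j)) * cnj (v $ j)))"
    by (subst sum.swap) (simp add: mult_ac)
  also have "\<dots> = w \<bullet>c (A *\<^sub>v v)"
    using assms by (auto simp: scalar_prod_def sum_distrib_left atLeast0LessThan intro!: sum.cong)
  finally show ?thesis .
qed

subsection \<open>Positive square roots and singular values\<close>

text \<open>The quadratic form at \<open>v\<close> is the squared length of
  \<open>B *\<^sub>v v\<close>.\<close>

lemma psd_mat_adjoint_mult:
  assumes "B \<in> carrier_mat m n"
  shows "psd_mat (mat_adjoint B * B)"
  unfolding psd_mat_def
proof (intro conjI ballI)
  have B': "mat_adjoint B \<in> carrier_mat n m" using assms by simp
  show "square_mat (mat_adjoint B * B)" using assms by simp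
  show "mat_adjoint (mat_adjoint B * B) = mat_adjoint B * B"
    using mat_adjoint_mult[OF B' assms] by simp
  fix v :: "complex vec" assume "v \<in> carrier_vec (dim_row (mat_adjoint B * B))"
  then have v: "v \<in> carrier_vec n" using assms by simp
  have "(mat_adjoint B * B *\<^sub>v v) \<bullet>c v = (B *\<^sub>v v) \<bullet>c (B *\<^sub>v v)"
    using assms v B' by (simp add: assoc_mult_mat_vec[of _ n m] inner_mat_adjoint[of _ m n])
  also have "\<dots> \<ge> 0" by (rule conjugate_square_ge_0_vec)
  finally show "0 \<le> Re ((mat_adjoint B * B *\<^sub>v v) \<bullet>c v)"
    by (simp add: less_eq_complex_def)
qed

lemma psd_spectral:
  assumes A: "A \<in> carrier_mat n n" "psd_mat A"
  obtains U d where "U \<in> carrier_mat n n" "mat_adjoint U * U = 1\<^sub>m n"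
    "A = U * mat_diag n (\<lambda>i. complex_of_real (d i)) * mat_adjoint U" "\<And>i. i < n \<Longrightarrow> d i \<ge> 0"
proof -
  have Ah: "mat_adjoint A = A" using A by (simp add: psd_mat_def)
  obtain U d where U: "U \<in> carrier_mat n n" "mat_adjoint U * U = 1\<^sub>m n"
    and AU: "A = U * mat_diag n (\<lambda>i. complex_of_real (d i)) * mat_adjoint U"
    by (rule hermitian_spectral[OF A(1) Ah])
  let ?D = "mat_diag n (\<lambda>i. complex_of_real (d i))"
  have U': "mat_adjoint U \<in> carrier_mat n n" and D: "?D \<in> carrier_mat n n" using U by auto
  have UA: "mat_adjoint U * A * U = ?D"
  proof -
    have "mat_adjoint U * A * U = (mat_adjoint U * U) * ?D * (mat_adjoint U * U)"
      unfolding AU using U(1) U' D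
      by (simp add: assoc_mult_mat[of _ n n _ n _ n] mult_carrier_mat[of _ n n _ n])
    then show ?thesis using U D by simp
  qed
  \<comment> \<open>The eigenvalue \<open>d i\<close> is the quadratic form of \<open>A\<close>
    evaluated at the \<open>i\<close>-th column of \<open>U\<close>.\<close>
  have "d i \<ge> 0" if i: "i < n" for i
  proof -
    let ?e = "unit_vec n i :: complex vec"
    have Ue: "U *\<^sub>v ?e \<in> carrier_vec n" using U by simp
    have "0 \<le> Re ((A *\<^sub>v (U *\<^sub>v ?e)) \<bullet>c (U *\<^sub>v ?e))"
      using A Ue by (auto simp: psd_mat_def)
    also have "(A *\<^sub>v (U *\<^sub>v ?e)) \<bullet>c (U *\<^sub>v ?e) = (mat_adjoint U *\<^sub>v (A *\<^sub>v (U *\<^sub>v ?e))) \<bullet>c ?e"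
      using U A Ue by (intro inner_mat_adjoint[symmetric, of _ n n]) auto
    also have "mat_adjoint U *\<^sub>v (A *\<^sub>v (U *\<^sub>v ?e)) = ?D *\<^sub>v ?e"
      unfolding UA[symmetric] using U(1) A(1) U' Ue
      by (simp add: assoc_mult_mat_vec[of _ n n _ n] mult_carrier_mat[of _ n n _ n])
    also have "(?D *\<^sub>v ?e) \<bullet>c ?e = complex_of_real (d i)"
    proof -
      have "conjugate ?e = ?e" by (intro eq_vecI) (auto simp: unit_vec_def)
      then show ?thesis using i by (simp add: mat_diag_def)
    qed
    finally show ?thesis by simp
  qed
  then show ?thesis using that U AU by blast
qed

text \<open>With \<open>S\<close> the diagonal matrix of the roots \<open>sqrt (d i)\<close>, the
  matrix is the adjoint of \<open>S * mat_adjoint U\<close> times \<open>S * mat_adjoint U\<close>,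
  so \<open>psd_mat_adjoint_mult\<close> applies.\<close>

lemma psd_mat_unitary_conj:
  assumes U: "U \<in> carrier_mat n n" and d: "\<And>i. i < n \<Longrightarrow> d i \<ge> 0"
  shows "psd_mat (U * mat_diag n (\<lambda>i. complex_of_real (d i)) * mat_adjoint U)"
proof -
  define S where "S = mat_diag n (\<lambda>i. complex_of_real (sqrt (d i)))"
  have S: "S \<in> carrier_mat n n" "mat_adjoint S = S"
    by (auto simp: S_def mat_adjoint_real_diag)
  have U': "mat_adjoint U \<in> carrier_mat n n" using U by simp
  have "S * S = mat_diag n (\<lambda>i. complex_of_real (d i))"
    unfolding S_def mat_diag_diag of_real_mult[symmetric]
    using d by (intro eq_matI) (auto simp: mat_diag_def)
  moreover have "mat_adjoint (S * mat_adjoint U) * (S * mat_adjoint U) = U * (S * S) * mat_adjoint U"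
    using U S U' by (simp add: mat_adjoint_mult[OF S(1) U'] assoc_mult_mat[of _ n n _ n _ n]
        mult_carrier_mat[of _ n n _ n])
  moreover have "psd_mat (mat_adjoint (S * mat_adjoint U) * (S * mat_adjoint U))"
    using S U' by (intro psd_mat_adjoint_mult mult_carrier_mat) auto
  ultimately show ?thesis by simp
qed

text \<open>With \<open>B = V E V\<^sup>*\<close>, \<open>C = U T U\<^sup>*\<close> and \<open>W = V\<^sup>* U\<close>, the hypothesis says \<open>E\<^sup>2 W = W T\<^sup>2\<close>;
  entrywise and by nonnegativity, this gives \<open>E W = W T\<close>.\<close>

lemma psd_square_inj:
  assumes B: "B \<in> carrier_mat n n" "psd_mat B" and C: "C \<in> carrier_mat n n" "psd_mat C"
    and eq: "B * B = C * C"
  shows "B = C"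
proof -
  note [simp] = mult_carrier_mat[of _ n n _ n]
  note assoc = assoc_mult_mat[of _ n n _ n _ n]
  obtain V e where V: "V \<in> carrier_mat n n" "mat_adjoint V * V = 1\<^sub>m n"
    and BV: "B = V * mat_diag n (\<lambda>i. complex_of_real (e i)) * mat_adjoint V"
    and e: "\<And>i. i < n \<Longrightarrow> e i \<ge> 0"
    using psd_spectral[OF B] by metis
  obtain U t where U: "U \<in> carrier_mat n n" "mat_adjoint U * U = 1\<^sub>m n"
    and CU: "C = U * mat_diag n (\<lambda>i. complex_of_real (t i)) * mat_adjoint U"
    and t: "\<And>i. i < n \<Longrightarrow> t i \<ge> 0"
    using psd_spectral[OF C] by metis
  define E where "E = mat_diag n (\<lambda>i. complex_of_real (e i))"
  define T where "T = mat_diag n (\<lambda>i. complex_of_real (t i))"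
  define W where "W = mat_adjoint V * U"
  have V' [simp]: "mat_adjoint V \<in> carrier_mat n n" and U' [simp]: "mat_adjoint U \<in> carrier_mat n n"
    and E [simp]: "E \<in> carrier_mat n n" and T [simp]: "T \<in> carrier_mat n n"
    using V U by (auto simp: E_def T_def)
  have W [simp]: "W \<in> carrier_mat n n" using V U by (simp add: W_def)
  have VV': "V * mat_adjoint V = 1\<^sub>m n" and UU': "U * mat_adjoint U = 1\<^sub>m n"
    using unitary_right_inverse V U by auto
  \<comment> \<open>\<open>assoc\<close> nests all products to the right, so an inverse pair has to
    be cancelled in front of a remaining factor \<open>X\<close>.\<close>
  have VVX: "mat_adjoint V * (V * X) = X" "V * (mat_adjoint V * X) = X"
    "mat_adjoint U * (U * X) = X" if "X \<in> carrier_mat n n" for X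
    using that V U VV' by (simp_all flip: assoc)
  have B': "B = V * E * mat_adjoint V" and C': "C = U * T * mat_adjoint U"
    using BV CU by (simp_all add: E_def T_def)
  have "E * E * W = mat_adjoint V * (B * B) * U"
    using V(1) U(1) by (simp add: B' W_def assoc VVX)
  also have "\<dots> = W * (T * T)"
    using V(1) U by (simp add: eq C' W_def assoc VVX right_mult_one_mat[of _ n n])
  finally have sq: "E * E * W = W * (T * T)" .
  have ent: "e i * e i = t j * t j \<or> W $$ (i, j) = 0" if "i < n" "j < n" for i j
  proof -
    have "(E * E * W) $$ (i, j) = complex_of_real (e i * e i) * W $$ (i, j)"
      unfolding E_def mat_diag_diag using that by (simp add: mat_diag_mult_left[OF W])
    moreover have "(W * (T * T)) $$ (i, j) = W $$ (i, j) * complex_of_real (t j * t j)"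
      unfolding T_def mat_diag_diag using that by (simp add: mat_diag_mult_right[OF W])
    ultimately have "complex_of_real (e i * e i) * W $$ (i, j) = complex_of_real (t j * t j) * W $$ (i, j)"
      by (simp only: sq mult.commute)
    then show ?thesis by (simp only: mult_cancel_right of_real_eq_iff) blast
  qed
  have EW: "E * W = W * T"
  proof -
    have "complex_of_real (e i) * W $$ (i, j) = W $$ (i, j) * complex_of_real (t j)"
      if "i < n" "j < n" for i j
      using ent[OF that] e[OF that(1)] t[OF that(2)]
      by (auto simp: power2_eq_iff_nonneg simp flip: power2_eq_square)
    then show ?thesis
      unfolding E_def T_def mat_diag_mult_left[OF W] mat_diag_mult_right[OF W]
      by (intro eq_matI) auto
  qed
  have "B = V * (E * W) * mat_adjoint U"
    using V(1) U(1) by (simp add: B' W_def assoc UU')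
  also have "\<dots> = C"
    unfolding EW using V(1) U(1) by (simp add: C' W_def assoc VVX)
  finally show ?thesis .
qed

text \<open>Evaluates the definite description in \<open>psd_sqrt\<close>: exhibiting one positive
  semidefinite root suffices, because \<open>psd_square_inj\<close> gives uniqueness.\<close>

lemma psd_sqrt_eqI:
  assumes "B \<in> carrier_mat n n" "psd_mat B" "B * B = A"
  shows "psd_sqrt A = B"
proof -
  have "A \<in> carrier_mat n n" using assms by auto
  then show ?thesis
    unfolding psd_sqrt_def using assms psd_square_inj by (intro the_equality) auto
qed

text \<open>Takes the place of a full singular value decomposition. \<open>V\<close> is an
  eigenbasis of the adjoint of \<open>M\<close> times \<open>M\<close>; the columns of
  \<open>M * V\<close> are orthogonal with lengths \<open>s i\<close>, and normalising those with
  \<open>s i > 0\<close> yields the left singular vectors.\<close>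

lemma trace_norm_spectral:
  assumes M: "M \<in> carrier_mat m n"
  obtains V s where "V \<in> carrier_mat n n" "mat_adjoint V * V = 1\<^sub>m n" "\<And>i. i < n \<Longrightarrow> s i \<ge> 0"
    "mat_adjoint (M * V) * (M * V) = mat_diag n (\<lambda>i. complex_of_real ((s i)\<^sup>2))"
    "trace_norm M = (\<Sum>i<n. s i)"
proof -
  note [simp] = mult_carrier_mat[of _ n n _ n]
  note assoc = assoc_mult_mat[of _ n n _ n _ n]
  have M' [simp]: "mat_adjoint M \<in> carrier_mat n m" using M by simp
  have MM: "mat_adjoint M * M \<in> carrier_mat n n" using M' M by (rule mult_carrier_mat)
  obtain V d where V: "V \<in> carrier_mat n n" "mat_adjoint V * V = 1\<^sub>m n"
    and MV: "mat_adjoint M * M = V * mat_diag n (\<lambda>i. complex_of_real (d i)) * mat_adjoint V"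
    and d: "\<And>i. i < n \<Longrightarrow> d i \<ge> 0"
    using psd_spectral[OF MM psd_mat_adjoint_mult[OF M]] by metis
  define s where "s i = sqrt (d i)" for i
  have s: "s i \<ge> 0" "(s i)\<^sup>2 = d i" if "i < n" for i
    using d[OF that] by (auto simp: s_def)
  define D where "D = mat_diag n (\<lambda>i. complex_of_real ((s i)\<^sup>2))"
  define S where "S = mat_diag n (\<lambda>i. complex_of_real (s i))"
  have V' [simp]: "mat_adjoint V \<in> carrier_mat n n" and S [simp]: "S \<in> carrier_mat n n"
    and D [simp]: "D \<in> carrier_mat n n"
    using V by (auto simp: S_def D_def)
  have "D = mat_diag n (\<lambda>i. complex_of_real (d i))"
    unfolding D_def using s(2) by (intro eq_matI) (auto simp: mat_diag_def simp del: of_real_power)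
  with MV have MV: "mat_adjoint M * M = V * D * mat_adjoint V" by simp
  have SS: "S * S = D"
    by (simp add: S_def D_def power2_eq_square)
  have VVX: "mat_adjoint V * (V * X) = X" if "X \<in> carrier_mat n n" for X
    using that V by (simp flip: assoc)
  \<comment> \<open>The root with eigenvalues \<open>s i\<close>; its trace is the sum of the
    singular values.\<close>
  let ?B = "V * S * mat_adjoint V"
  have "?B * ?B = mat_adjoint M * M"
    unfolding MV SS[symmetric] using V(1) by (simp add: assoc VVX)
  moreover have "psd_mat ?B"
    unfolding S_def using V(1) s(1) by (intro psd_mat_unitary_conj)
  moreover have "?B \<in> carrier_mat n n" using V by simp
  ultimately have "psd_sqrt (mat_adjoint M * M) = ?B"
    by (intro psd_sqrt_eqI)
  then have "trace_norm M = (\<Sum>i<n. s i)"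
    using mat_trace_unitary_conj[OF V S] by (simp add: trace_norm_def S_def mat_trace_diag)
  moreover have "mat_adjoint (M * V) * (M * V) = mat_adjoint V * (mat_adjoint M * M) * V"
    using M V(1) by (simp add: mat_adjoint_mult[OF M V(1)] assoc_mult_mat[of _ n n _ m _ n]
        assoc_mult_mat[of _ n m _ n _ n] assoc_mult_mat[of _ n n _ n _ n]
        mult_carrier_mat[of _ m n _ n] mult_carrier_mat[of _ n m _ n])
  then have "mat_adjoint (M * V) * (M * V) = D"
    unfolding MV using V by (simp add: assoc VVX right_mult_one_mat[OF D])
  ultimately show ?thesis
    using that V s(1) unfolding D_def by blast
qed

section \<open>Bessel's inequality and the trace norm of a rank-one mixture\<close>

text \<open>With \<open>y\<close> the orthogonal projection of \<open>x\<close> onto the span of the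
  \<open>f i\<close>, expanding the squared length of \<open>x - y\<close>, which is nonnegative,
  gives the squared length of \<open>x\<close> minus the sum of the squared coefficients.\<close>

lemma bessel_inequality:
  fixes f :: "'i \<Rightarrow> 'r \<Rightarrow> complex" and x :: "'r \<Rightarrow> complex"
  assumes I: "finite I"
    and orth: "\<And>i j. i \<in> I \<Longrightarrow> j \<in> I \<Longrightarrow> (\<Sum>r\<in>R. cnj (f i r) * f j r) = of_bool (i = j)"
  shows "(\<Sum>i\<in>I. (cmod (\<Sum>r\<in>R. cnj (f i r) * x r))\<^sup>2) \<le> (\<Sum>r\<in>R. (cmod (x r))\<^sup>2)"
proof -
  define a where "a i = (\<Sum>r\<in>R. cnj (f i r) * x r)" for i
  define y where "y r = (\<Sum>i\<in>I. a i * f i r)" for r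
  define S where "S = (\<Sum>i\<in>I. cnj (a i) * a i)"
  have S: "S = complex_of_real (\<Sum>i\<in>I. (cmod (a i))\<^sup>2)"
    by (simp add: S_def complex_norm_square mult.commute del: of_real_power)
  have fy: "(\<Sum>r\<in>R. cnj (f i r) * y r) = a i" if "i \<in> I" for i
  proof -
    have "(\<Sum>r\<in>R. cnj (f i r) * y r) = (\<Sum>j\<in>I. a j * (\<Sum>r\<in>R. cnj (f i r) * f j r))"
      unfolding y_def sum_distrib_left by (subst sum.swap) (simp add: mult_ac)
    also have "\<dots> = (\<Sum>j\<in>I. if i = j then a j else 0)"
      using that by (intro sum.cong) (auto simp: orth)
    finally show ?thesis using I that by simp
  qed
  \<comment> \<open>Pairing with \<open>y\<close> needs only the coefficients of \<open>z\<close>.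
    Those of \<open>x\<close> and of \<open>y\<close> are both \<open>a\<close>, so both pairings
    equal \<open>S\<close>.\<close>
  have yz: "(\<Sum>r\<in>R. cnj (y r) * z r) = (\<Sum>i\<in>I. cnj (a i) * (\<Sum>r\<in>R. cnj (f i r) * z r))" for z
    unfolding y_def cnj_sum sum_distrib_left sum_distrib_right
    by (subst sum.swap) (simp add: mult_ac)
  have yx: "(\<Sum>r\<in>R. cnj (y r) * x r) = S" and yy: "(\<Sum>r\<in>R. cnj (y r) * y r) = S"
    by (simp_all add: yz fy S_def a_def)
  \<comment> \<open>The conjugate of \<open>yx\<close>; \<open>S\<close> is real.\<close>
  have xy: "(\<Sum>r\<in>R. cnj (x r) * y r) = S"
    using arg_cong[OF yx, of cnj] by (simp add: S mult.commute)
  have "complex_of_real (\<Sum>r\<in>R. (cmod (x r - y r))\<^sup>2) = (\<Sum>r\<in>R. cnj (x r - y r) * (x r - y r))"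
    by (simp add: complex_norm_square mult.commute del: of_real_power complex_cnj_diff)
  also have "\<dots> = (\<Sum>r\<in>R. cnj (x r) * x r) - (\<Sum>r\<in>R. cnj (x r) * y r)
      - ((\<Sum>r\<in>R. cnj (y r) * x r) - (\<Sum>r\<in>R. cnj (y r) * y r))"
    by (simp add: algebra_simps sum.distrib sum_subtractf)
  also have "\<dots> = (\<Sum>r\<in>R. cnj (x r) * x r) - S" by (simp add: yx yy xy)
  also have "\<dots> = complex_of_real ((\<Sum>r\<in>R. (cmod (x r))\<^sup>2) - (\<Sum>i\<in>I. (cmod (a i))\<^sup>2))"
    by (simp add: S complex_norm_square mult.commute del: of_real_power)
  finally have "(\<Sum>r\<in>R. (cmod (x r - y r))\<^sup>2) = (\<Sum>r\<in>R. (cmod (x r))\<^sup>2) - (\<Sum>i\<in>I. (cmod (a i))\<^sup>2)"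
    by (simp only: of_real_eq_iff)
  moreover have "(\<Sum>r\<in>R. (cmod (x r - y r))\<^sup>2) \<ge> 0" by (simp add: sum_nonneg)
  ultimately show ?thesis by (simp add: a_def)
qed

text \<open>In effect the triangle inequality for the trace norm, combined with its value on
  rank-one matrices; working with the singular vectors of \<open>M\<close> gives the bound directly,
  without first showing that \<open>trace_norm\<close> is a norm.\<close>

lemma trace_norm_rank_one_sum:
  fixes p :: "nat \<Rightarrow> real" and u v :: "nat \<Rightarrow> nat \<Rightarrow> complex"
  assumes M: "M \<in> carrier_mat m n" and p: "\<And>k. k < N \<Longrightarrow> p k \<ge> 0"
    and Muv: "\<And>r c. r < m \<Longrightarrow> c < n \<Longrightarrow>
      M $$ (r, c) = (\<Sum>k<N. complex_of_real (p k) * (u k r * v k c))"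
  shows "trace_norm M \<le>
    (\<Sum>k<N. p k * (L2_set (\<lambda>r. cmod (u k r)) {..<m} * L2_set (\<lambda>c. cmod (v k c)) {..<n}))"
proof -
  obtain V s where V: "V \<in> carrier_mat n n" "mat_adjoint V * V = 1\<^sub>m n"
    and s: "\<And>i. i < n \<Longrightarrow> s i \<ge> 0"
    and GG: "mat_adjoint (M * V) * (M * V) = mat_diag n (\<lambda>i. complex_of_real ((s i)\<^sup>2))"
    and tn: "trace_norm M = (\<Sum>i<n. s i)"
    using trace_norm_spectral[OF M] by metis
  define G where "G = M * V"
  have G: "G \<in> carrier_mat m n" using M V by (simp add: G_def)
  \<comment> \<open>Only positive singular values are kept: \<open>f i\<close> below divides by
    \<open>s i\<close>, and the others add nothing to the trace norm.\<close>
  define I where "I = {i. i < n \<and> s i > 0}"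
  have I: "finite I" "I \<subseteq> {..<n}" by (auto simp: I_def)
  have Gorth: "(\<Sum>r<m. cnj (G $$ (r, i)) * G $$ (r, j)) = (if i = j then complex_of_real ((s i)\<^sup>2) else 0)"
    if "i < n" "j < n" for i j
  proof -
    have "(\<Sum>r<m. cnj (G $$ (r, i)) * G $$ (r, j)) = (mat_adjoint G * G) $$ (i, j)"
      using G that by (auto simp: scalar_prod_def atLeast0LessThan intro!: sum.cong)
    also have "\<dots> = mat_diag n (\<lambda>i. complex_of_real ((s i)\<^sup>2)) $$ (i, j)"
      by (simp only: GG[folded G_def])
    also have "\<dots> = (if i = j then complex_of_real ((s i)\<^sup>2) else 0)"
      using that by (auto simp: mat_diag_def)
    finally show ?thesis .
  qed
  have Vorth: "(\<Sum>c<n. cnj (V $$ (c, i)) * V $$ (c, j)) = of_bool (i = j)"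
    if "i < n" "j < n" for i j
  proof -
    have "(\<Sum>c<n. cnj (V $$ (c, i)) * V $$ (c, j)) = (mat_adjoint V * V) $$ (i, j)"
      using V(1) that by (auto simp: scalar_prod_def atLeast0LessThan intro!: sum.cong)
    also have "\<dots> = of_bool (i = j)"
      unfolding V(2) using that by simp
    finally show ?thesis .
  qed
  \<comment> \<open>\<open>f i\<close> is a left singular vector. \<open>b\<close> has no conjugate
    because the rank-one terms contain the transpose of \<open>v k\<close>, not its adjoint.\<close>
  define f where "f i r = G $$ (r, i) / complex_of_real (s i)" for i r
  define a where "a k i = (\<Sum>r<m. cnj (f i r) * u k r)" for k i
  define b where "b k i = (\<Sum>c<n. V $$ (c, i) * v k c)" for k i
  have forth: "(\<Sum>r<m. cnj (f i r) * f j r) = of_bool (i = j)" if "i \<in> I" "j \<in> I" for i j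
  proof -
    have "(\<Sum>r<m. cnj (f i r) * f j r) =
        (\<Sum>r<m. cnj (G $$ (r, i)) * G $$ (r, j)) / (complex_of_real (s i) * complex_of_real (s j))"
      by (simp add: f_def sum_divide_distrib)
    then show ?thesis
      using that Gorth[of i j] by (auto simp: I_def power2_eq_square)
  qed
  have a_le: "L2_set (\<lambda>i. cmod (a k i)) I \<le> L2_set (\<lambda>r. cmod (u k r)) {..<m}" for k
    unfolding L2_set_def a_def using forth
    by (intro real_sqrt_le_mono bessel_inequality I(1))
  have b_le: "L2_set (\<lambda>i. cmod (b k i)) I \<le> L2_set (\<lambda>c. cmod (v k c)) {..<n}" for k
  proof -
    \<comment> \<open>\<open>b k i\<close> is the coefficient of \<open>v k\<close> along the
      conjugated column \<open>i\<close> of \<open>V\<close>; these columns are again orthonormal,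
      and the double \<open>cnj\<close> fits the shape of \<open>bessel_inequality\<close>.\<close>
    have "(\<Sum>i\<in>I. (cmod (\<Sum>c<n. cnj (cnj (V $$ (c, i))) * v k c))\<^sup>2) \<le> (\<Sum>c<n. (cmod (v k c))\<^sup>2)"
    proof (rule bessel_inequality[OF I(1)])
      fix i j assume "i \<in> I" "j \<in> I"
      then show "(\<Sum>c<n. cnj (cnj (V $$ (c, i))) * cnj (V $$ (c, j))) = of_bool (i = j)"
        using Vorth[of j i] by (auto simp: I_def mult.commute)
    qed
    then show ?thesis by (simp add: L2_set_def b_def)
  qed
  have s_eq: "complex_of_real (s i) = (\<Sum>k<N. complex_of_real (p k) * (a k i * b k i))"
    if i: "i \<in> I" for i
  proof -
    have Gri: "G $$ (r, i) = (\<Sum>k<N. complex_of_real (p k) * (u k r * b k i))" if r: "r < m" for r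
    proof -
      have "G $$ (r, i) = (\<Sum>c<n. M $$ (r, c) * V $$ (c, i))"
        using M V(1) r i by (auto simp: G_def I_def scalar_prod_def atLeast0LessThan intro!: sum.cong)
      also have "\<dots> = (\<Sum>c<n. \<Sum>k<N. complex_of_real (p k) * (u k r * (V $$ (c, i) * v k c)))"
        using r by (simp add: Muv sum_distrib_left mult_ac)
      also have "\<dots> = (\<Sum>k<N. complex_of_real (p k) * (u k r * b k i))"
        by (subst sum.swap) (simp add: b_def sum_distrib_left)
      finally show ?thesis .
    qed
    \<comment> \<open>Column \<open>i\<close> of \<open>G\<close> has squared length
      \<open>(s i)\<^sup>2\<close>, so its inner product with \<open>f i\<close> is
      \<open>s i\<close>; inserting the mixture for \<open>G\<close> then produces \<open>a\<close>
      and \<open>b\<close>.\<close>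
    have "complex_of_real (s i) = (\<Sum>r<m. cnj (G $$ (r, i)) * G $$ (r, i)) / complex_of_real (s i)"
      using i Gorth[of i i] by (simp add: I_def power2_eq_square)
    also have "\<dots> = (\<Sum>r<m. cnj (f i r) * G $$ (r, i))"
      by (simp add: f_def sum_divide_distrib)
    also have "\<dots> = (\<Sum>r<m. \<Sum>k<N. complex_of_real (p k) * (cnj (f i r) * u k r * b k i))"
      by (simp add: Gri sum_distrib_left mult_ac)
    also have "\<dots> = (\<Sum>k<N. complex_of_real (p k) * (a k i * b k i))"
      by (subst sum.swap) (simp add: a_def sum_distrib_left sum_distrib_right)
    finally show ?thesis .
  qed
  have s_le: "s i \<le> (\<Sum>k<N. p k * (cmod (a k i) * cmod (b k i)))" if "i \<in> I" for i
  proof -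
    have "s i = cmod (complex_of_real (s i))" using that by (simp add: I_def)
    also have "\<dots> \<le> (\<Sum>k<N. cmod (complex_of_real (p k) * (a k i * b k i)))"
      unfolding s_eq[OF that] by (rule norm_sum)
    also have "\<dots> = (\<Sum>k<N. p k * (cmod (a k i) * cmod (b k i)))"
      using p by (intro sum.cong) (auto simp: norm_mult)
    finally show ?thesis .
  qed
  have "trace_norm M = (\<Sum>i\<in>I. s i)"
    unfolding tn using s by (intro sum.mono_neutral_right) (auto simp: I_def order_less_le)
  also have "\<dots> \<le> (\<Sum>i\<in>I. \<Sum>k<N. p k * (cmod (a k i) * cmod (b k i)))"
    by (intro sum_mono s_le)
  \<comment> \<open>The redundant absolute values match the form of Cauchy-Schwarz in
    \<open>L2_set_mult_ineq\<close>.\<close>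
  also have "\<dots> = (\<Sum>k<N. p k * (\<Sum>i\<in>I. \<bar>cmod (a k i)\<bar> * \<bar>cmod (b k i)\<bar>))"
    by (subst sum.swap) (simp add: sum_distrib_left)
  also have "\<dots> \<le> (\<Sum>k<N. p k * (L2_set (\<lambda>r. cmod (u k r)) {..<m} * L2_set (\<lambda>c. cmod (v k c)) {..<n}))"
    by (intro sum_mono mult_left_mono order_trans[OF L2_set_mult_ineq] mult_mono a_le b_le
        L2_set_nonneg p) auto
  finally show ?thesis .
qed

subsection \<open>Separable states\<close>

text \<open>The sum is the trace of the adjoint of \<open>\<rho>\<close> times
  \<open>\<rho>\<close>, that is, the sum of the squared eigenvalues. The eigenvalues are
  nonnegative with sum 1, so each is at most 1 and squaring does not increase it.\<close>

lemma density_mat_purity: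
  assumes "density_mat n \<rho>"
  shows "(\<Sum>j<n. \<Sum>i<n. (cmod (\<rho> $$ (i, j)))\<^sup>2) \<le> 1"
proof -
  have \<rho>: "\<rho> \<in> carrier_mat n n" "psd_mat \<rho>" and tr: "mat_trace \<rho> = 1"
    using assms by (auto simp: density_mat_def)
  obtain U d where U: "U \<in> carrier_mat n n" "mat_adjoint U * U = 1\<^sub>m n"
    and \<rho>U: "\<rho> = U * mat_diag n (\<lambda>i. complex_of_real (d i)) * mat_adjoint U"
    and d: "\<And>i. i < n \<Longrightarrow> d i \<ge> 0"
    using psd_spectral[OF \<rho>] by metis
  define D where "D = mat_diag n (\<lambda>i. complex_of_real (d i))"
  have D [simp]: "D \<in> carrier_mat n n" and U' [simp]: "mat_adjoint U \<in> carrier_mat n n"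
    using U by (auto simp: D_def)
  note [simp] = mult_carrier_mat[of _ n n _ n]
  note assoc = assoc_mult_mat[of _ n n _ n _ n]
  have "complex_of_real (\<Sum>i<n. d i) = 1"
    using tr mat_trace_unitary_conj[OF U D] unfolding \<rho>U D_def by (simp add: mat_trace_diag)
  then have sum1: "(\<Sum>i<n. d i) = 1" by (simp only: of_real_eq_1_iff)
  have UUX: "mat_adjoint U * (U * X) = X" if "X \<in> carrier_mat n n" for X
    using that U by (simp flip: assoc)
  have "\<rho> * \<rho> = U * (D * D) * mat_adjoint U"
    unfolding \<rho>U D_def[symmetric] using U(1) by (simp add: assoc UUX)
  then have "mat_trace (mat_adjoint \<rho> * \<rho>) = mat_trace (D * D)"
    using \<rho>(2) mat_trace_unitary_conj[OF U, of "D * D"] by (simp add: psd_mat_def)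
  moreover have "mat_trace (mat_adjoint \<rho> * \<rho>) = (\<Sum>j<n. \<Sum>i<n. cnj (\<rho> $$ (i, j)) * \<rho> $$ (i, j))"
    using \<rho>(1) by (auto simp: mat_trace_def scalar_prod_def atLeast0LessThan intro!: sum.cong)
  ultimately have "complex_of_real (\<Sum>j<n. \<Sum>i<n. (cmod (\<rho> $$ (i, j)))\<^sup>2) = complex_of_real (\<Sum>i<n. d i * d i)"
    by (simp add: complex_norm_square mult.commute D_def mat_trace_diag del: of_real_power)
  then have "(\<Sum>j<n. \<Sum>i<n. (cmod (\<rho> $$ (i, j)))\<^sup>2) = (\<Sum>i<n. d i * d i)"
    by (simp only: of_real_eq_iff)
  also have "\<dots> \<le> (\<Sum>i<n. d i * 1)"
  proof (intro sum_mono mult_left_mono)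
    fix i assume i: "i \<in> {..<n}"
    show "d i \<le> 1" unfolding sum1[symmetric] using d i by (intro member_le_sum) auto
    show "0 \<le> d i" using d i by simp
  qed
  finally show ?thesis using sum1 by simp
qed

lemma sum_lessThan_plus:
  fixes h :: "nat \<Rightarrow> 'a::comm_monoid_add"
  shows "(\<Sum>r<m + n. h r) = (\<Sum>r<m. h r) + (\<Sum>r<n. h (m + r))"
  by (induction n) (simp_all add: add.assoc)

text \<open>Column stacking puts entry \<open>(i, j)\<close> at position \<open>j * d + i\<close>;
  cutting the range into \<open>d\<close> runs of length \<open>d\<close> recovers the
  columns.\<close>

lemma sum_mod_div_square:
  fixes g :: "nat \<Rightarrow> nat \<Rightarrow> 'a::comm_monoid_add"
  shows "(\<Sum>r<d\<^sup>2. g (r mod d) (r div d)) = (\<Sum>j<d. \<Sum>i<d. g i j)"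
proof -
  have "(\<Sum>r<d * d. g (r mod d) (r div d)) = (\<Sum>j<d. \<Sum>r\<in>{j * d..<j * d + d}. g (r mod d) (r div d))"
    by (rule sum.nat_group[symmetric])
  also have "\<dots> = (\<Sum>j<d. \<Sum>i<d. g i j)"
  proof (rule sum.cong[OF refl])
    fix j
    have "(\<Sum>r\<in>{j * d..<j * d + d}. g (r mod d) (r div d)) =
        (\<Sum>i\<in>{0..<d}. g ((i + j * d) mod d) ((i + j * d) div d))"
      using sum.shift_bounds_nat_ivl[of "\<lambda>r. g (r mod d) (r div d)" 0 "j * d" d]
      by (simp add: add.commute)
    then show "(\<Sum>r\<in>{j * d..<j * d + d}. g (r mod d) (r div d)) = (\<Sum>i<d. g i j)"
      by (auto simp: atLeast0LessThan intro!: sum.cong)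
  qed
  finally show ?thesis by (simp add: power2_eq_square)
qed

text \<open>The part \<open>r \<ge> l\<close> is \<open>col_stack \<sigma>\<close>; \<open>u\<^sub>k\<close> is the case \<open>c = \<alpha>\<close>, \<open>\<sigma> = \<rho>A\<^sub>k\<close>, and \<open>v\<^sub>k\<close> the case
  \<open>c = \<beta>\<close>, \<open>\<sigma> = \<rho>B\<^sub>k\<close>.\<close>

definition bordered_vec :: "nat \<Rightarrow> real \<Rightarrow> nat \<Rightarrow> complex mat \<Rightarrow> nat \<Rightarrow> complex" where
  "bordered_vec l c d \<sigma> r =
     (if r < l then complex_of_real c else \<sigma> $$ ((r - l) mod d, (r - l) div d))"

lemma bordered_vec_L2:
  assumes "density_mat d \<sigma>"
  shows "L2_set (\<lambda>r. cmod (bordered_vec l c d \<sigma> r)) {..<l + d\<^sup>2} \<le> sqrt (real l * c\<^sup>2 + 1)"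
proof -
  let ?h = "\<lambda>r. (cmod (bordered_vec l c d \<sigma> r))\<^sup>2"
  have "(\<Sum>r<l + d\<^sup>2. ?h r) = (\<Sum>r<l. ?h r) + (\<Sum>r<d\<^sup>2. ?h (l + r))"
    by (rule sum_lessThan_plus)
  also have "(\<Sum>r<l. ?h r) = real l * c\<^sup>2"
    by (simp add: bordered_vec_def)
  also have "(\<Sum>r<d\<^sup>2. ?h (l + r)) = (\<Sum>r<d\<^sup>2. (cmod (\<sigma> $$ (r mod d, r div d)))\<^sup>2)"
    by (simp add: bordered_vec_def)
  also have "\<dots> = (\<Sum>j<d. \<Sum>i<d. (cmod (\<sigma> $$ (i, j)))\<^sup>2)"
    by (rule sum_mod_div_square)
  also have "\<dots> \<le> 1" using assms by (rule density_mat_purity)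
  finally show ?thesis by (simp add: L2_set_def)
qed

section \<open>Entries of the bordered realignment of a separable state\<close>

lemma block_index_less:
  fixes i a m n :: nat
  assumes "i < m" "a < n"
  shows "i * n + a < m * n"
proof -
  have "i * n + a < Suc i * n" using assms by simp
  also have "\<dots> \<le> m * n" using assms by (intro mult_le_mono1) simp
  finally show ?thesis .
qed

lemma index_kron:
  assumes "A \<in> carrier_mat m m" "B \<in> carrier_mat n n" "i < m" "j < m" "a < n" "b < n"
  shows "kron A B $$ (i * n + a, j * n + b) = A $$ (i, j) * B $$ (a, b)"
proof -
  have "dim_row A = m" "dim_col A = m" "dim_row B = n" "dim_col B = n" using assms by auto
  then show ?thesis
    using assms(3-6) block_index_less[of i m a n] block_index_less[of j m b n]
    by (simp add: kron_def)
qed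

text \<open>Realignment turns each product state into a rank-one matrix. The borders fit the same
  pattern because the local states have trace 1, which makes the marginals mixtures with the same
  weights, and the corner fits because the weights sum to 1.\<close>

lemma separable_M_mat:
  assumes "separable dA dB \<rho>"
  obtains N :: nat and p :: "nat \<Rightarrow> real" and \<rho>A \<rho>B where "\<forall>k<N. 0 \<le> p k"
    "\<forall>k<N. density_mat dA (\<rho>A k)" "\<forall>k<N. density_mat dB (\<rho>B k)" "(\<Sum>k<N. p k) = 1"
    "\<forall>r<l + dA\<^sup>2. \<forall>c<l + dB\<^sup>2. M_mat dA dB \<alpha> \<beta> l \<rho> $$ (r, c) =
      (\<Sum>k<N. complex_of_real (p k) * (bordered_vec l \<alpha> dA (\<rho>A k) r * bordered_vec l \<beta> dB (\<rho>B k) c))"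
proof -
  obtain N :: nat and p :: "nat \<Rightarrow> real" and \<rho>A \<rho>B where p: "\<forall>k<N. 0 \<le> p k \<and> p k \<le> 1 \<and> density_mat dA (\<rho>A k) \<and> density_mat dB (\<rho>B k)"
    and p1: "(\<Sum>k<N. p k) = 1"
    and \<rho>: "\<rho> = mat (dA * dB) (dA * dB)
              (\<lambda>(i, j). \<Sum>k<N. complex_of_real (p k) * kron (\<rho>A k) (\<rho>B k) $$ (i, j))"
    using assms unfolding separable_def by blast
  have A: "\<rho>A k \<in> carrier_mat dA dA" "(\<Sum>i<dA. \<rho>A k $$ (i, i)) = 1"
    and B: "\<rho>B k \<in> carrier_mat dB dB" "(\<Sum>i<dB. \<rho>B k $$ (i, i)) = 1" if "k < N" for k
    using p that by (auto simp: density_mat_def mat_trace_def)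
  have ent: "\<rho> $$ (i * dB + a, j * dB + b) =
      (\<Sum>k<N. complex_of_real (p k) * (\<rho>A k $$ (i, j) * \<rho>B k $$ (a, b)))"
    if "i < dA" "j < dA" "a < dB" "b < dB" for i j a b
    using that block_index_less[of i dA a dB] block_index_less[of j dA b dB]
    by (simp add: \<rho> index_kron[OF A(1) B(1)])
  have pA: "ptrace_A dA dB \<rho> $$ (a, b) = (\<Sum>k<N. complex_of_real (p k) * \<rho>B k $$ (a, b))"
    if "a < dB" "b < dB" for a b
  proof -
    have "ptrace_A dA dB \<rho> $$ (a, b) =
        (\<Sum>i<dA. \<Sum>k<N. complex_of_real (p k) * (\<rho>A k $$ (i, i) * \<rho>B k $$ (a, b)))"
      using that by (auto simp: ptrace_A_def ent intro!: sum.cong)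
    also have "\<dots> = (\<Sum>k<N. complex_of_real (p k) * ((\<Sum>i<dA. \<rho>A k $$ (i, i)) * \<rho>B k $$ (a, b)))"
      by (subst sum.swap) (simp add: sum_distrib_left sum_distrib_right)
    finally show ?thesis using A(2) by simp
  qed
  have pB: "ptrace_B dA dB \<rho> $$ (i, j) = (\<Sum>k<N. complex_of_real (p k) * \<rho>A k $$ (i, j))"
    if "i < dA" "j < dA" for i j
  proof -
    have "ptrace_B dA dB \<rho> $$ (i, j) =
        (\<Sum>a<dB. \<Sum>k<N. complex_of_real (p k) * (\<rho>A k $$ (i, j) * \<rho>B k $$ (a, a)))"
      using that by (auto simp: ptrace_B_def ent intro!: sum.cong)
    also have "\<dots> = (\<Sum>k<N. complex_of_real (p k) * (\<rho>A k $$ (i, j) * (\<Sum>a<dB. \<rho>B k $$ (a, a))))"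
      by (subst sum.swap) (simp add: sum_distrib_left)
    finally show ?thesis using B(2) by simp
  qed
  have idx: "r mod d < d" "r div d < d" if "r < d\<^sup>2" for r d :: nat
  proof -
    show "r div d < d" using that by (simp add: power2_eq_square less_mult_imp_div_less)
    then show "r mod d < d" by (cases "d = 0") auto
  qed
  have oA: "omega l (ptrace_B dA dB \<rho>) $$ (r, i) = (\<Sum>k<N. complex_of_real (p k) * \<rho>A k $$ (r mod dA, r div dA))"
    if "r < dA\<^sup>2" "i < l" for r i
    using that idx[of r dA] pB[of "r mod dA" "r div dA"]
    by (simp add: omega_def col_stack_def ptrace_B_def power2_eq_square)
  have oB: "omega l (ptrace_A dA dB \<rho>) $$ (r, i) = (\<Sum>k<N. complex_of_real (p k) * \<rho>B k $$ (r mod dB, r div dB))"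
    if "r < dB\<^sup>2" "i < l" for r i
    using that idx[of r dB] pA[of "r mod dB" "r div dB"]
    by (simp add: omega_def col_stack_def ptrace_A_def power2_eq_square)
  \<comment> \<open>The row index selects a block, hence an entry of \<open>\<rho>A k\<close>, and
    the column index a place inside it, hence an entry of \<open>\<rho>B k\<close>. Both are decoded
    as in \<open>oA\<close> and \<open>oB\<close>, so the borders align with this block.\<close>
  have re: "realign dA dB \<rho> $$ (r, c) = (\<Sum>k<N. complex_of_real (p k) *
      (\<rho>A k $$ (r mod dA, r div dA) * \<rho>B k $$ (c mod dB, c div dB)))"
    if "r < dA\<^sup>2" "c < dB\<^sup>2" for r c
    using that idx[of r dA] idx[of c dB]
    by (simp add: realign_def col_stack_def mat_block_def ent power2_eq_square)
  have dims: "dim_row (omega l (ptrace_A dA dB \<rho>)) = dB\<^sup>2" "dim_col (omega l (ptrace_A dA dB \<rho>)) = l"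
    "dim_row (omega l (ptrace_B dA dB \<rho>)) = dA\<^sup>2" "dim_col (omega l (ptrace_B dA dB \<rho>)) = l"
    "dim_row (realign dA dB \<rho>) = dA\<^sup>2" "dim_col (realign dA dB \<rho>) = dB\<^sup>2"
    "dim_row (ones_mat l) = l" "dim_col (ones_mat l) = l"
    by (auto simp: omega_def ptrace_A_def ptrace_B_def realign_def ones_mat_def power2_eq_square)
  \<comment> \<open>The constant 1 is written as the total weight, so that the corner is a mixture
    too.\<close>
  have ones: "ones_mat l $$ (r, c) = (\<Sum>k<N. complex_of_real (p k))" if "r < l" "c < l" for r c
    using that p1 by (simp add: ones_mat_def flip: of_real_sum)
  show ?thesis
  proof (rule that; (intro allI impI)?)
    fix r c assume rc: "r < l + dA\<^sup>2" "c < l + dB\<^sup>2"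
    show "M_mat dA dB \<alpha> \<beta> l \<rho> $$ (r, c) = (\<Sum>k<N. complex_of_real (p k) *
        (bordered_vec l \<alpha> dA (\<rho>A k) r * bordered_vec l \<beta> dB (\<rho>B k) c))"
      using rc
      \<comment> \<open>The four cases are the four blocks of \<open>M_mat\<close>.\<close>
      by (cases "r < l"; cases "c < l")
        (simp_all add: M_mat_def dims ones oA oB re bordered_vec_def sum_distrib_left mult_ac)
  qed (use p p1 in auto)
qed

theorem theorem1:
  fixes dA dB l :: nat and \<alpha> \<beta> :: real and \<rho> :: "complex mat"
  assumes "dA \<ge> 1" and "dB \<ge> 1" and "l \<ge> 1"
    and "density_mat (dA * dB) \<rho>"
    and "separable dA dB \<rho>"
  shows "trace_norm (M_mat dA dB \<alpha> \<beta> l \<rho>)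
           \<le> sqrt ((real l * \<alpha>\<^sup>2 + 1) * (real l * \<beta>\<^sup>2 + 1))"
proof -
  obtain N :: nat and p :: "nat \<Rightarrow> real" and \<rho>A \<rho>B where p: "\<forall>k<N. 0 \<le> p k"
    and A: "\<forall>k<N. density_mat dA (\<rho>A k)" and B: "\<forall>k<N. density_mat dB (\<rho>B k)" and p1: "(\<Sum>k<N. p k) = 1"
    and M: "\<forall>r<l + dA\<^sup>2. \<forall>c<l + dB\<^sup>2. M_mat dA dB \<alpha> \<beta> l \<rho> $$ (r, c) =
      (\<Sum>k<N. complex_of_real (p k) * (bordered_vec l \<alpha> dA (\<rho>A k) r * bordered_vec l \<beta> dB (\<rho>B k) c))"
    by (rule separable_M_mat[OF assms(5)])
  let ?K = "sqrt ((real l * \<alpha>\<^sup>2 + 1) * (real l * \<beta>\<^sup>2 + 1))"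
  have "M_mat dA dB \<alpha> \<beta> l \<rho> \<in> carrier_mat (l + dA\<^sup>2) (l + dB\<^sup>2)"
    by (auto simp: M_mat_def ones_mat_def realign_def)
  then have "trace_norm (M_mat dA dB \<alpha> \<beta> l \<rho>) \<le> (\<Sum>k<N. p k *
      (L2_set (\<lambda>r. cmod (bordered_vec l \<alpha> dA (\<rho>A k) r)) {..<l + dA\<^sup>2} *
       L2_set (\<lambda>c. cmod (bordered_vec l \<beta> dB (\<rho>B k) c)) {..<l + dB\<^sup>2}))"
    by (rule trace_norm_rank_one_sum[OF _ p[rule_format] M[rule_format]])
  \<comment> \<open>The bounds from \<open>bordered_vec_L2\<close> do not depend on
    \<open>k\<close>, so the weights merely average the constant \<open>?K\<close>.\<close>
  also have "\<dots> \<le> (\<Sum>k<N. p k * ?K)"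
    unfolding real_sqrt_mult using A B p
    by (intro sum_mono mult_left_mono mult_mono bordered_vec_L2 L2_set_nonneg) auto
  also have "\<dots> = ?K" using p1 by (simp flip: sum_distrib_right)
  finally show ?thesis .
qed

end
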